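(* Let $X$ be a real Hilbert space, let $C$ be a closed convex subset of $X$ with $0\in C$, let $K:=\overline{\operatorname{cone}}(C\times\{1\})\subseteq X\times\mathbb{R}$, and let $(y,s)\in X\times\mathbb{R}$. Let $$\psi\colon \left]0,+\infty\right[\to\mathbb{R}\colon \alpha\mapsto \|P_{\alpha C}(y)-y\|^2+(\alpha-s)^2 = d^2_{\alpha C}(y)+(\alpha-s)^2=\alpha^2\big\|(y/\alpha)-P_C(y/\alpha)\big\|^2+(\alpha-s)^2 .$$ Then the function $$\Psi\colon\mathbb{R}\to\left]-\infty,+\infty\right]\colon \alpha \mapsto \begin{cases} +\infty, &\text{if } \alpha<0;\\ d^2_{\operatorname{rec}(C)}(y)+s^2, &\text{if } \alpha=0;\\ \alpha^2d^2_{C}(y/\alpha)+(\alpha-s)^2, &\text{if } \alpha>0\end{cases}$$ is the lower semicontinuous hull of $\psi$. The function $\Psi$ is strictly convex and supercoercive, and it has a unique minimizer, denoted by $\alpha^*\ge 0$. Moreover, $$P_K(y,s) = \begin{cases} \big(P_{\operatorname{rec}(C)}(y),0\big), &\text{if } \alpha^*=0;\\ \big(\alpha^*P_{C}(y/\alpha^* ),\alpha^*\big), &\text{if } \alpha^*>0.\end{cases}$$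
   Context: $X$ is a real Hilbert space with norm $\|\cdot\|$; $X\times\mathbb{R}$ carries the product Hilbert space structure, $\|(x,r)\|^2=\|x\|^2+r^2$. For a set $S$, $\operatorname{cone}(S):=\bigcup_{\rho>0}\rho S$ and $\overline{\operatorname{cone}}(S)$ is its closure. For a nonempty closed convex set $D$, $P_D$ is the (nearest point) projection onto $D$ and $d_D(x)=\|x-P_D(x)\|$ is the distance to $D$; $d_D^2(x)=(d_D(x))^2$. The recession cone of $C$ is $\operatorname{rec}(C):=\{x\in X: x+C\subseteq C\}$, which is a closed convex cone containing $0$. The lower semicontinuous hull of a function defined on $\left]0,+\infty\right[$ means the largest lower semicontinuous function $\mathbb{R}\to[-\infty,+\infty]$ majorized by the extension of that function by $+\infty$ to $\mathbb{R}$. A function $f\colon\mathbb{R}\to\left]-\infty,+\infty\right]$ is supercoercive if $f(\alpha)/|\alpha|\to+\infty$ as $|\alpha|\to+\infty$; strict convexity is understood on the domain $\{\alpha: f(\alpha)<+\infty\}$. *)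

theory Defs
  imports "HOL-Analysis.Analysis"
begin

text \<open>The library's \<open>closest_point\<close> is restricted to Heine-Borel (hence finite-dimensional)
  spaces, so the projection is defined here for arbitrary inner product spaces. It is meaningful
  when the nearest point exists and is unique, e.g. for nonempty closed convex sets in a Hilbert
  space.\<close>

definition proj :: "'a::real_inner set \<Rightarrow> 'a \<Rightarrow> 'a" where
  "proj D x = (THE p. p \<in> D \<and> (\<forall>z\<in>D. dist x p \<le> dist x z))"

definition proj_dist :: "'a::real_inner set \<Rightarrow> 'a \<Rightarrow> real" where
  "proj_dist D x = norm (x - proj D x)"

text \<open>Only positive multiples are taken, unlike in \<open>cone hull\<close> and \<open>conic hull\<close>.\<close>

definition pos_cone :: "'a::real_vector set \<Rightarrow> 'a set" where
  "pos_cone S = (\<Union>\<rho>\<in>{0<..}. (\<lambda>x. \<rho> *\<^sub>R x) ` S)"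

definition rec_cone :: "'a::real_vector set \<Rightarrow> 'a set" where
  "rec_cone C = {x. (\<lambda>c. x + c) ` C \<subseteq> C}"

definition lower_semicont :: "('a::topological_space \<Rightarrow> ereal) \<Rightarrow> bool" where
  "lower_semicont f \<longleftrightarrow> (\<forall>x. f x \<le> Liminf (at x) f)"

definition extend_infty :: "'a set \<Rightarrow> ('a \<Rightarrow> real) \<Rightarrow> 'a \<Rightarrow> ereal" where
  "extend_infty D f x = (if x \<in> D then ereal (f x) else \<infinity>)"

text \<open>\<open>F\<close> is the largest lower semicontinuous function majorized by the extension by \<open>\<infinity>\<close>
  of the function \<open>f\<close> with domain \<open>D\<close>.\<close>

definition is_lsc_hull_on ::
  "'a::topological_space set \<Rightarrow> ('a \<Rightarrow> real) \<Rightarrow> ('a \<Rightarrow> ereal) \<Rightarrow> bool" where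
  "is_lsc_hull_on D f F \<longleftrightarrow>
     lower_semicont F \<and> F \<le> extend_infty D f \<and>
     (\<forall>G. lower_semicont G \<and> G \<le> extend_infty D f \<longrightarrow> G \<le> F)"

text \<open>Strict convexity on the effective domain, for functions that avoid \<open>-\<infinity>\<close>. Strictness
  of the inequality makes the domain convex.\<close>

definition strictly_convex_fun :: "('a::real_vector \<Rightarrow> ereal) \<Rightarrow> bool" where
  "strictly_convex_fun f \<longleftrightarrow>
     (\<forall>a b t. f a < \<infinity> \<and> f b < \<infinity> \<and> a \<noteq> b \<and> 0 < t \<and> t < 1 \<longrightarrow>
        f ((1 - t) *\<^sub>R a + t *\<^sub>R b) < ereal (1 - t) * f a + ereal t * f b)"

definition supercoercive :: "(real \<Rightarrow> ereal) \<Rightarrow> bool" where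
  "supercoercive f \<longleftrightarrow> ((\<lambda>\<alpha>. f \<alpha> / ereal \<bar>\<alpha>\<bar>) \<longlongrightarrow> \<infinity>) at_infinity"

text \<open>Relevant only for \<open>\<alpha> > 0\<close>.\<close>

definition psi :: "'a::real_inner set \<Rightarrow> 'a \<Rightarrow> real \<Rightarrow> real \<Rightarrow> real" where
  "psi C y s \<alpha> = (norm (proj ((\<lambda>x. \<alpha> *\<^sub>R x) ` C) y - y))\<^sup>2 + (\<alpha> - s)\<^sup>2"

definition Psi :: "'a::real_inner set \<Rightarrow> 'a \<Rightarrow> real \<Rightarrow> real \<Rightarrow> ereal" where
  "Psi C y s \<alpha> =
     (if \<alpha> < 0 then \<infinity>
      else if \<alpha> = 0 then ereal ((proj_dist (rec_cone C) y)\<^sup>2 + s\<^sup>2)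
      else ereal (\<alpha>\<^sup>2 * (proj_dist C (y /\<^sub>R \<alpha>))\<^sup>2 + (\<alpha> - s)\<^sup>2))"

end

theory Submission
  imports Defs
begin

text \<open>
  Write \<open>K\<close> for the closed cone generated by \<open>C \<times> {1}\<close>. Its slice at height \<open>\<alpha>\<close> is
  \<open>\<alpha> C\<close> for \<open>\<alpha> > 0\<close>, \<open>rec_cone C\<close> for \<open>\<alpha> = 0\<close>, and empty for \<open>\<alpha> < 0\<close>
  (\<open>mem_closure_pos_cone_iff\<close>). Consequently \<open>Psi C y s \<alpha>\<close> is the minimum of the squared
  distance from \<open>(y, s)\<close> to the points of \<open>K\<close> at height \<open>\<alpha>\<close>, attained at the explicit
  point \<open>slice_proj C y \<alpha>\<close> (\<open>Psi_le_dist\<close>, \<open>Psi_attained\<close>). Everything follows from this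
  description: minimizing \<open>Psi\<close> means projecting \<open>(y, s)\<close> onto \<open>K\<close>, so the minimizer is
  the height of that projection; strict convexity is inherited from the squared norm because \<open>K\<close>
  is convex; and \<open>Psi C y s \<alpha> \<ge> (\<alpha> - s)\<^sup>2\<close> gives supercoercivity.

  Lower semicontinuity cannot be read off from norm compactness in infinite dimension. It comes
  from \<open>decseq_closed_convex_Inter\<close>: a decreasing sequence of closed convex sets at bounded
  distance from a point \<open>z\<close> has a common point within that distance. This is applied to the parts of
  \<open>K\<close> in shrinking slabs around a given height; the constant sequence yields the nearest-point
  theorem. Finally \<open>rec_cone C \<subseteq> \<alpha> C\<close> bounds \<open>Psi C y s \<alpha>\<close> by
  \<open>d\<^sup>2(y) + (\<alpha> - s)\<^sup>2\<close>, with \<open>d\<close> the distance to \<open>rec_cone C\<close>, whose limit at \<open>0\<close> is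
  \<open>Psi C y s 0\<close>; so no lower semicontinuous minorant of \<open>psi\<close> can exceed \<open>Psi\<close> at \<open>0\<close>.
\<close>

section \<open>Nearest points in Hilbert spaces\<close>

lemma parallelogram_midpoint:
  fixes z a b :: "'a::real_inner"
  shows "(dist a b)\<^sup>2 = 2 * (dist z a)\<^sup>2 + 2 * (dist z b)\<^sup>2 - 4 * (dist z (midpoint a b))\<^sup>2"
proof -
  define u v where "u = z - a" and "v = z - b"
  have "z - midpoint a b = (1 / 2) *\<^sub>R (u + v)"
  proof -
    have "z = (1 / 2) *\<^sub>R (z + z)" by (simp flip: scaleR_2)
    then have "z - midpoint a b = (1 / 2) *\<^sub>R (z + z) - (1 / 2) *\<^sub>R (a + b)"
      by (simp add: midpoint_def)
    also have "\<dots> = (1 / 2) *\<^sub>R (u + v)"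
      unfolding scaleR_diff_right[symmetric] by (simp add: u_def v_def algebra_simps)
    finally show ?thesis .
  qed
  then have "4 * (dist z (midpoint a b))\<^sup>2 = (norm (u + v))\<^sup>2"
    by (simp add: dist_norm power_divide)
  moreover have "(norm (v - u))\<^sup>2 = 2 * (norm u)\<^sup>2 + 2 * (norm v)\<^sup>2 - (norm (u + v))\<^sup>2"
    unfolding power2_norm_eq_inner
    by (simp add: inner_diff_left inner_diff_right inner_add_left inner_add_right inner_commute)
  moreover have "dist a b = norm (v - u)" "dist z a = norm u" "dist z b = norm v"
    by (simp_all add: dist_norm u_def v_def)
  ultimately show ?thesis by simp
qed

lemma convex_midpoint:
  assumes "convex D" "p \<in> D" "q \<in> D"
  shows "midpoint p q \<in> D"
  using closed_segment_subset[OF assms(2,3,1)] midpoint_in_closed_segment by blast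

text \<open>In each set a point is taken whose distance to \<open>z\<close> exceeds the distance of the set by at most
  \<open>1 / Suc n\<close>; the parallelogram law makes these points a Cauchy sequence.\<close>

lemma decseq_closed_convex_Inter:
  fixes z :: "'a::{real_inner, complete_space}" and S :: "nat \<Rightarrow> 'a set"
  assumes closed: "\<And>n. closed (S n)" and conv: "\<And>n. convex (S n)" and ne: "\<And>n. S n \<noteq> {}"
    and dec: "decseq S" and bound: "\<And>n. infdist z (S n) \<le> r"
  shows "\<exists>q. (\<forall>n. q \<in> S n) \<and> dist z q \<le> r"
proof -
  define d where "d n = infdist z (S n)" for n
  have "incseq d"
    unfolding d_def incseq_def using dec ne by (auto intro!: infdist_mono simp: decseq_def)
  moreover have "\<And>n. d n \<le> r" using bound by (simp add: d_def)
  ultimately obtain l where l: "d \<longlonglongrightarrow> l"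
    using incseq_convergent[of d r] by blast
  have lr: "l \<le> r" using l \<open>\<And>n. d n \<le> r\<close> by (intro LIMSEQ_le_const2) auto
  have d0: "0 \<le> d n" for n by (simp add: d_def infdist_nonneg)
  have "\<exists>q\<in>S n. dist z q < d n + 1 / real (Suc n)" for n
    using ne[of n] infdist_notempty[of "S n" z] cINF_less_iff[of "S n" "dist z" "d n + 1 / real (Suc n)"]
    unfolding d_def by auto
  then obtain q where qS: "\<And>n. q n \<in> S n" and qd: "\<And>n. dist z (q n) < d n + 1 / real (Suc n)"
    by metis
  have dq: "d n \<le> dist z (q n)" for n unfolding d_def by (rule infdist_le[OF qS])
  have el: "(\<lambda>n. dist z (q n)) \<longlonglongrightarrow> l"
  proof (rule tendsto_sandwich[of d _ _ "\<lambda>n. d n + 1 / real (Suc n)"])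
    show "(\<lambda>n. d n + 1 / real (Suc n)) \<longlonglongrightarrow> l"
      using tendsto_add[OF l LIMSEQ_inverse_real_of_nat] by (simp add: field_simps)
  qed (use dq qd l in \<open>auto intro!: always_eventually less_imp_le\<close>)
  have Cau: "Cauchy q"
  proof (rule metric_CauchyI)
    fix \<epsilon> :: real assume "0 < \<epsilon>"
    define \<delta> where "\<delta> = \<epsilon>\<^sup>2 / 8"
    have \<delta>: "0 < \<delta>" using \<open>0 < \<epsilon>\<close> by (simp add: \<delta>_def)
    have "\<forall>\<^sub>F n in sequentially. (d n)\<^sup>2 > l\<^sup>2 - \<delta>"
      using \<delta> by (intro order_tendstoD(1)[OF tendsto_power[OF l]]) auto
    moreover have "\<forall>\<^sub>F n in sequentially. (dist z (q n))\<^sup>2 < l\<^sup>2 + \<delta>"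
      using \<delta> by (intro order_tendstoD(2)[OF tendsto_power[OF el]]) auto
    ultimately have "\<forall>\<^sub>F n in sequentially. (d n)\<^sup>2 > l\<^sup>2 - \<delta> \<and> (dist z (q n))\<^sup>2 < l\<^sup>2 + \<delta>"
      by (rule eventually_conj)
    then obtain N where N: "\<And>n. n \<ge> N \<Longrightarrow> (d n)\<^sup>2 > l\<^sup>2 - \<delta> \<and> (dist z (q n))\<^sup>2 < l\<^sup>2 + \<delta>"
      unfolding eventually_sequentially by blast
    have "dist (q m) (q n) < \<epsilon>" if "m \<ge> N" "n \<ge> N" for m n
    proof -
      have "q k \<in> S N" if "k \<ge> N" for k using qS[of k] dec that by (auto simp: decseq_def)
      then have "midpoint (q m) (q n) \<in> S N"
        using conv[of N] that by (intro convex_midpoint) auto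
      then have "d N \<le> dist z (midpoint (q m) (q n))"
        unfolding d_def by (rule infdist_le)
      then have "(d N)\<^sup>2 \<le> (dist z (midpoint (q m) (q n)))\<^sup>2"
        using d0 by (rule power_mono)
      then have "(dist (q m) (q n))\<^sup>2 < \<epsilon>\<^sup>2"
        using N[of N] N[OF that(1)] N[OF that(2)] parallelogram_midpoint[of "q m" "q n" z]
        unfolding \<delta>_def by simp
      then show ?thesis using \<open>0 < \<epsilon>\<close> by (simp add: power_less_imp_less_base)
    qed
    then show "\<exists>N. \<forall>m\<ge>N. \<forall>n\<ge>N. dist (q m) (q n) < \<epsilon>" by blast
  qed
  then obtain p where p: "q \<longlonglongrightarrow> p" using Cauchy_convergent convergent_def by blast
  have "p \<in> S n" for n
  proof (rule Lim_in_closed_set[OF closed _ _ p])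
    show "\<forall>\<^sub>F k in sequentially. q k \<in> S n"
      using eventually_ge_at_top[of n] by eventually_elim (use qS dec in \<open>auto simp: decseq_def\<close>)
  qed simp
  moreover have "(\<lambda>n. dist z (q n)) \<longlonglongrightarrow> dist z p" by (intro tendsto_intros p)
  then have "dist z p = l" using el LIMSEQ_unique by blast
  ultimately show ?thesis using lr by auto
qed

lemma nearest_point_exists:
  fixes z :: "'a::{real_inner, complete_space}"
  assumes "closed D" "convex D" "D \<noteq> {}"
  shows "\<exists>p\<in>D. \<forall>w\<in>D. dist z p \<le> dist z w"
proof -
  obtain p where "p \<in> D" "dist z p \<le> infdist z D"
    using decseq_closed_convex_Inter[of "\<lambda>_. D" z "infdist z D"] assms by (auto simp: decseq_def)
  then show ?thesis using infdist_le order_trans by blast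
qed

lemma nearest_point_unique:
  fixes z :: "'a::real_inner"
  assumes "convex D" and p: "p \<in> D" "\<And>w. w \<in> D \<Longrightarrow> dist z p \<le> dist z w"
    and q: "q \<in> D" "\<And>w. w \<in> D \<Longrightarrow> dist z q \<le> dist z w"
  shows "p = q"
proof -
  have "midpoint p q \<in> D"
    using assms(1) p(1) q(1) by (rule convex_midpoint)
  then have "(dist z p)\<^sup>2 \<le> (dist z (midpoint p q))\<^sup>2" "(dist z q)\<^sup>2 \<le> (dist z (midpoint p q))\<^sup>2"
    using p q by (auto intro!: power_mono)
  then have "(dist p q)\<^sup>2 \<le> 0" using parallelogram_midpoint[of p q z] by linarith
  then show ?thesis by simp
qed

lemma proj_eqI:
  fixes z :: "'a::real_inner"
  assumes "convex D" "p \<in> D" "\<And>w. w \<in> D \<Longrightarrow> dist z p \<le> dist z w"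
  shows "proj D z = p"
  unfolding proj_def
proof (rule the_equality)
  show "p \<in> D \<and> (\<forall>w\<in>D. dist z p \<le> dist z w)" using assms by blast
  fix q assume "q \<in> D \<and> (\<forall>w\<in>D. dist z q \<le> dist z w)"
  then show "q = p"
    by (intro nearest_point_unique[OF assms(1) _ _ assms(2,3)]) simp_all
qed

lemma
  fixes z :: "'a::{real_inner, complete_space}"
  assumes "closed D" "convex D" "D \<noteq> {}"
  shows proj_in: "proj D z \<in> D"
    and proj_le: "\<And>w. w \<in> D \<Longrightarrow> dist z (proj D z) \<le> dist z w"
proof -
  obtain p where p: "p \<in> D" "\<And>w. w \<in> D \<Longrightarrow> dist z p \<le> dist z w"
    using nearest_point_exists[OF assms] by metis
  with proj_eqI[of D p z] assms have "proj D z = p" by blast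
  with p show "proj D z \<in> D" "\<And>w. w \<in> D \<Longrightarrow> dist z (proj D z) \<le> dist z w" by auto
qed

lemma dist_scaleR_right:
  fixes y p :: "'a::real_normed_vector"
  assumes "\<alpha> > 0"
  shows "dist y (\<alpha> *\<^sub>R p) = \<alpha> * norm (y /\<^sub>R \<alpha> - p)"
proof -
  have "y - \<alpha> *\<^sub>R p = \<alpha> *\<^sub>R (y /\<^sub>R \<alpha> - p)"
    using assms by (simp add: scaleR_diff_right)
  then show ?thesis using assms by (simp add: dist_norm)
qed

lemma proj_scaleR_image:
  fixes y :: "'a::{real_inner, complete_space}"
  assumes "closed C" "convex C" "C \<noteq> {}" "\<alpha> > 0"
  shows "proj ((\<lambda>x. \<alpha> *\<^sub>R x) ` C) y = \<alpha> *\<^sub>R proj C (y /\<^sub>R \<alpha>)"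
proof (rule proj_eqI)
  have scale: "dist y (\<alpha> *\<^sub>R x) = \<alpha> * dist (y /\<^sub>R \<alpha>) x" for x
    using dist_scaleR_right[OF \<open>\<alpha> > 0\<close>] by (simp add: dist_norm)
  show "dist y (\<alpha> *\<^sub>R proj C (y /\<^sub>R \<alpha>)) \<le> dist y w" if "w \<in> (\<lambda>x. \<alpha> *\<^sub>R x) ` C" for w
    using that proj_le[OF assms(1-3)] \<open>\<alpha> > 0\<close> by (auto simp: scale)
  show "\<alpha> *\<^sub>R proj C (y /\<^sub>R \<alpha>) \<in> (\<lambda>x. \<alpha> *\<^sub>R x) ` C"
    using proj_in[OF assms(1-3)] by blast
qed (use assms in \<open>auto intro: convex_scaling\<close>)

section \<open>Slices of the closed cone over a closed convex set\<close>

lemma mem_pos_cone_Times_iff: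
  "(x, \<alpha>) \<in> pos_cone (C \<times> {1::real}) \<longleftrightarrow> \<alpha> > 0 \<and> x /\<^sub>R \<alpha> \<in> C"
proof
  assume "\<alpha> > 0 \<and> x /\<^sub>R \<alpha> \<in> C"
  then show "(x, \<alpha>) \<in> pos_cone (C \<times> {1::real})"
    unfolding pos_cone_def by (auto intro!: bexI[of _ \<alpha>] image_eqI[of _ _ "(x /\<^sub>R \<alpha>, 1)"])
qed (auto simp: pos_cone_def)

lemma convex_pos_cone:
  assumes "convex S" shows "convex (pos_cone S)"
proof (rule convexI)
  fix x y and u v :: real
  assume "x \<in> pos_cone S" "y \<in> pos_cone S" and uv: "0 \<le> u" "0 \<le> v" "u + v = 1"
  then obtain \<rho> a \<sigma> b where r: "\<rho> > 0" "a \<in> S" "x = \<rho> *\<^sub>R a" "\<sigma> > 0" "b \<in> S" "y = \<sigma> *\<^sub>R b"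
    by (auto simp: pos_cone_def)
  define \<tau> where "\<tau> = u * \<rho> + v * \<sigma>"
  have "0 \<le> u * \<rho>" "0 \<le> v * \<sigma>" "0 < u * \<rho> \<or> 0 < v * \<sigma>"
    using r uv by (auto simp: zero_less_mult_iff)
  then have \<tau>: "\<tau> > 0" unfolding \<tau>_def by linarith
  have "(u * \<rho> / \<tau>) *\<^sub>R a + (v * \<sigma> / \<tau>) *\<^sub>R b \<in> S"
    using assms r uv \<tau> by (intro convexD) (auto simp: \<tau>_def add_divide_distrib[symmetric])
  moreover have "u *\<^sub>R x + v *\<^sub>R y = \<tau> *\<^sub>R ((u * \<rho> / \<tau>) *\<^sub>R a + (v * \<sigma> / \<tau>) *\<^sub>R b)"
    using \<tau> r by (simp add: scaleR_add_right)
  ultimately show "u *\<^sub>R x + v *\<^sub>R y \<in> pos_cone S"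
    unfolding pos_cone_def using \<tau> by auto
qed

lemma rec_cone_add: "u \<in> rec_cone C \<Longrightarrow> c \<in> C \<Longrightarrow> u + c \<in> C"
  by (auto simp: rec_cone_def)

lemma closed_rec_cone:
  fixes C :: "'a::real_normed_vector set"
  assumes "closed C" shows "closed (rec_cone C)"
proof -
  have "rec_cone C = (\<Inter>c\<in>C. (\<lambda>x. x + c) -` C)" by (auto simp: rec_cone_def)
  then show ?thesis using assms by (auto intro!: closed_INT closed_vimage continuous_intros)
qed

lemma convex_rec_cone:
  assumes "convex C" shows "convex (rec_cone C)"
proof (rule convexI)
  fix x y and u v :: real
  assume *: "x \<in> rec_cone C" "y \<in> rec_cone C" "0 \<le> u" "0 \<le> v" "u + v = 1"
  have "(u *\<^sub>R x + v *\<^sub>R y) + c \<in> C" if "c \<in> C" for c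
  proof -
    have "u *\<^sub>R (x + c) + v *\<^sub>R (y + c) \<in> C"
      using * that assms by (intro convexD) (auto intro: rec_cone_add)
    also have "u *\<^sub>R (x + c) + v *\<^sub>R (y + c) = u *\<^sub>R x + v *\<^sub>R y + (u + v) *\<^sub>R c"
      by (simp add: algebra_simps)
    finally show ?thesis using * by simp
  qed
  then show "u *\<^sub>R x + v *\<^sub>R y \<in> rec_cone C" by (auto simp: rec_cone_def)
qed

lemma zero_in_rec_cone: "0 \<in> rec_cone C"
  by (simp add: rec_cone_def)

lemma rec_cone_scaleR:
  assumes "convex C" "0 \<in> C" "u \<in> rec_cone C" "t \<ge> 0"
  shows "t *\<^sub>R u \<in> C"
proof -
  have nat: "real n *\<^sub>R u \<in> C" for n
    by (induction n) (use assms in \<open>auto simp: scaleR_add_left intro: rec_cone_add\<close>)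
  obtain n where n: "t < real n" using reals_Archimedean2 by blast
  then have "(t / real n) *\<^sub>R (real n *\<^sub>R u) + (1 - t / real n) *\<^sub>R 0 \<in> C"
    using assms nat by (intro convexD) auto
  then show ?thesis using n assms by simp
qed

lemma mem_closure_pos_cone_iff:
  fixes C :: "'a::real_normed_vector set"
  assumes C: "closed C" "convex C" "0 \<in> C"
  shows "(x, \<alpha>) \<in> closure (pos_cone (C \<times> {1::real})) \<longleftrightarrow>
    \<alpha> > 0 \<and> x /\<^sub>R \<alpha> \<in> C \<or> \<alpha> = 0 \<and> x \<in> rec_cone C"
proof
  assume "(x, \<alpha>) \<in> closure (pos_cone (C \<times> {1::real}))"
  then obtain f where f: "\<And>n. f n \<in> pos_cone (C \<times> {1})" and lim: "f \<longlonglongrightarrow> (x, \<alpha>)"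
    unfolding closure_sequential by blast
  define X A where "X n = fst (f n)" and "A n = snd (f n)" for n
  have X: "X \<longlonglongrightarrow> x" and A: "A \<longlonglongrightarrow> \<alpha>"
    using tendsto_fst[OF lim] tendsto_snd[OF lim] by (simp_all add: X_def[abs_def] A_def[abs_def])
  have mem: "A n > 0 \<and> X n /\<^sub>R A n \<in> C" for n
    using f[of n] mem_pos_cone_Times_iff[of "X n" "A n" C] by (simp add: X_def A_def)
  have "\<alpha> \<ge> 0" using A by (rule LIMSEQ_le_const) (use mem in \<open>auto intro: less_imp_le\<close>)
  moreover have "x /\<^sub>R \<alpha> \<in> C" if "\<alpha> > 0"
  proof (rule closed_sequentially[OF C(1)])
    show "(\<lambda>n. X n /\<^sub>R A n) \<longlonglongrightarrow> x /\<^sub>R \<alpha>" using that by (intro tendsto_intros X A) auto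
  qed (use mem in auto)
  moreover have "x + c \<in> C" if "\<alpha> = 0" "c \<in> C" for c
  proof (rule Lim_in_closed_set[OF C(1)])
    have "(\<lambda>n. X n + (1 - A n) *\<^sub>R c) \<longlonglongrightarrow> x + (1 - \<alpha>) *\<^sub>R c" by (intro tendsto_intros X A)
    then show "(\<lambda>n. X n + (1 - A n) *\<^sub>R c) \<longlonglongrightarrow> x + c" using that by simp
    \<comment> \<open>For small \<open>A n\<close> the term is a convex combination of \<open>X n / A n\<close> and \<open>c\<close>.\<close>
    have "\<forall>\<^sub>F n in sequentially. A n < 1" using A that by (intro order_tendstoD(2)[OF A]) simp
    then show "\<forall>\<^sub>F n in sequentially. X n + (1 - A n) *\<^sub>R c \<in> C"
    proof eventually_elim
      case (elim n)
      have "A n *\<^sub>R (X n /\<^sub>R A n) + (1 - A n) *\<^sub>R c \<in> C"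
        using mem[of n] elim that C(2) by (intro convexD) auto
      moreover have "A n \<noteq> 0" using mem[of n] by simp
      ultimately show ?case by simp
    qed
  qed simp
  ultimately show "\<alpha> > 0 \<and> x /\<^sub>R \<alpha> \<in> C \<or> \<alpha> = 0 \<and> x \<in> rec_cone C"
    by (cases "\<alpha> = 0") (auto simp: rec_cone_def)
next
  assume "\<alpha> > 0 \<and> x /\<^sub>R \<alpha> \<in> C \<or> \<alpha> = 0 \<and> x \<in> rec_cone C"
  then show "(x, \<alpha>) \<in> closure (pos_cone (C \<times> {1::real}))"
  proof
    assume "\<alpha> > 0 \<and> x /\<^sub>R \<alpha> \<in> C"
    then show ?thesis using mem_pos_cone_Times_iff closure_subset by blast
  next
    assume *: "\<alpha> = 0 \<and> x \<in> rec_cone C"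
    have "(x, inverse (real (Suc n))) \<in> pos_cone (C \<times> {1})" for n
      using rec_cone_scaleR[of C x "real (Suc n)"] C * by (simp add: mem_pos_cone_Times_iff)
    moreover have "(\<lambda>n. (x, inverse (real (Suc n)))) \<longlonglongrightarrow> (x, \<alpha>)"
      using * LIMSEQ_inverse_real_of_nat by (intro tendsto_Pair) simp_all
    ultimately show ?thesis
      unfolding closure_sequential
      by (intro exI[of _ "\<lambda>n. (x, inverse (real (Suc n)))"] conjI allI)
  qed
qed

section \<open>The marginal function of the squared distance to the cone\<close>

lemma dist_prod_sq: "(dist (y, s) (x, \<alpha>))\<^sup>2 = (dist y x)\<^sup>2 + (\<alpha> - s)\<^sup>2" for s \<alpha> :: real
  by (simp add: dist_Pair_Pair dist_real_def power2_commute)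

text \<open>For \<open>C\<close> closed and convex with \<open>0 \<in> C\<close>, this is the point at height \<open>\<alpha> \<ge> 0\<close> of
  the closed cone over \<open>C \<times> {1}\<close> that is nearest to \<open>(y, s)\<close>; it does not depend on \<open>s\<close>. Values at \<open>\<alpha> < 0\<close> are irrelevant.\<close>

definition slice_proj :: "'a::real_inner set \<Rightarrow> 'a \<Rightarrow> real \<Rightarrow> 'a \<times> real" where
  "slice_proj C y \<alpha> =
     (if \<alpha> = 0 then (proj (rec_cone C) y, 0) else (\<alpha> *\<^sub>R proj C (y /\<^sub>R \<alpha>), \<alpha>))"

lemma snd_slice_proj [simp]: "snd (slice_proj C y \<alpha>) = \<alpha>"
  by (simp add: slice_proj_def)

lemma scaled_dist_sq:
  fixes y p :: "'a::real_normed_vector"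
  assumes "\<alpha> > 0"
  shows "\<alpha>\<^sup>2 * (norm (y /\<^sub>R \<alpha> - p))\<^sup>2 = (dist y (\<alpha> *\<^sub>R p))\<^sup>2"
  unfolding dist_scaleR_right[OF assms] by (simp only: power_mult_distrib)

lemma Psi_eq_dist_slice_proj:
  assumes "\<alpha> \<ge> 0"
  shows "Psi C y s \<alpha> = ereal ((dist (y, s) (slice_proj C y \<alpha>))\<^sup>2)"
proof (cases "\<alpha> = 0")
  case True
  then show ?thesis unfolding slice_proj_def
    by (simp add: Psi_def dist_prod_sq proj_dist_def flip: dist_norm)
next
  case False
  with assms have "\<alpha> > 0" by simp
  then show ?thesis
    by (simp add: Psi_def slice_proj_def dist_prod_sq proj_dist_def scaled_dist_sq)
qed

lemma Psi_neg: "\<alpha> < 0 \<Longrightarrow> Psi C y s \<alpha> = \<infinity>"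
  by (simp add: Psi_def)

lemma Psi_finite_imp_nonneg: "Psi C y s \<alpha> < \<infinity> \<Longrightarrow> \<alpha> \<ge> 0"
  using Psi_neg[of \<alpha> C y s] by (cases "\<alpha> < 0") auto

lemma Psi_nonneg: "0 \<le> Psi C y s \<alpha>"
  by (simp add: Psi_def)

lemma Psi_attained:
  fixes C :: "'a::{real_inner, complete_space} set"
  assumes C: "closed C" "convex C" "0 \<in> C" and "\<alpha> \<ge> 0"
  shows "slice_proj C y \<alpha> \<in> closure (pos_cone (C \<times> {1}))"
proof (cases "\<alpha> = 0")
  case True
  have "proj (rec_cone C) y \<in> rec_cone C"
    using C zero_in_rec_cone by (intro proj_in closed_rec_cone convex_rec_cone) auto
  then show ?thesis using True C by (simp add: slice_proj_def mem_closure_pos_cone_iff)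
next
  case False
  then show ?thesis using C \<open>\<alpha> \<ge> 0\<close> proj_in[of C "y /\<^sub>R \<alpha>"]
    by (auto simp: slice_proj_def mem_closure_pos_cone_iff)
qed

lemma Psi_le_dist:
  fixes C :: "'a::{real_inner, complete_space} set"
  assumes C: "closed C" "convex C" "0 \<in> C" and q: "q \<in> closure (pos_cone (C \<times> {1}))"
  shows "Psi C y s (snd q) \<le> ereal ((dist (y, s) q)\<^sup>2)" and "snd q \<ge> 0"
proof -
  obtain x \<alpha> where q_eq: "q = (x, \<alpha>)" by force
  with q have x: "\<alpha> > 0 \<and> x /\<^sub>R \<alpha> \<in> C \<or> \<alpha> = 0 \<and> x \<in> rec_cone C"
    using mem_closure_pos_cone_iff[OF C] by simp
  then show nonneg: "snd q \<ge> 0" using q_eq by auto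
  have "dist y (fst (slice_proj C y \<alpha>)) \<le> dist y x"
    using x
  proof
    assume x: "\<alpha> > 0 \<and> x /\<^sub>R \<alpha> \<in> C"
    then have "x = \<alpha> *\<^sub>R (x /\<^sub>R \<alpha>)" by simp
    then have "x \<in> (\<lambda>x. \<alpha> *\<^sub>R x) ` C" using x by blast
    then have "dist y (proj ((\<lambda>x. \<alpha> *\<^sub>R x) ` C) y) \<le> dist y x"
      using C by (intro proj_le closed_scaling convex_scaling) auto
    moreover have "proj ((\<lambda>x. \<alpha> *\<^sub>R x) ` C) y = \<alpha> *\<^sub>R proj C (y /\<^sub>R \<alpha>)"
      using x C by (intro proj_scaleR_image) auto
    ultimately show ?thesis using x by (simp add: slice_proj_def)
  next
    assume "\<alpha> = 0 \<and> x \<in> rec_cone C"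
    then show ?thesis using C
      by (auto simp: slice_proj_def intro!: proj_le closed_rec_cone convex_rec_cone)
  qed
  then have "(dist y (fst (slice_proj C y \<alpha>)))\<^sup>2 \<le> (dist y x)\<^sup>2" by (simp add: power_mono)
  moreover have "slice_proj C y \<alpha> = (fst (slice_proj C y \<alpha>), \<alpha>)" by (simp add: prod_eq_iff)
  ultimately have "(dist (y, s) (slice_proj C y \<alpha>))\<^sup>2 \<le> (dist (y, s) (x, \<alpha>))\<^sup>2"
    by (metis dist_prod_sq add_le_cancel_right)
  then show "Psi C y s (snd q) \<le> ereal ((dist (y, s) q)\<^sup>2)"
    using Psi_eq_dist_slice_proj[of \<alpha> C y s] nonneg q_eq by simp
qed

lemma convex_closure_pos_cone: "convex C \<Longrightarrow> convex (closure (pos_cone (C \<times> {1::real})))"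
  for C :: "'a::real_normed_vector set"
  by (intro convex_closure convex_pos_cone convex_Times) auto

lemma psi_eq:
  fixes C :: "'a::{real_inner, complete_space} set"
  assumes "closed C" "convex C" "0 \<in> C" "\<alpha> > 0"
  shows "psi C y s \<alpha> = \<alpha>\<^sup>2 * (norm (y /\<^sub>R \<alpha> - proj C (y /\<^sub>R \<alpha>)))\<^sup>2 + (\<alpha> - s)\<^sup>2"
proof -
  have "proj ((\<lambda>x. \<alpha> *\<^sub>R x) ` C) y = \<alpha> *\<^sub>R proj C (y /\<^sub>R \<alpha>)"
    using assms by (intro proj_scaleR_image) auto
  then show ?thesis
    using assms by (simp add: psi_def scaled_dist_sq dist_norm norm_minus_commute)
qed

lemma Psi_eq_psi:
  fixes C :: "'a::{real_inner, complete_space} set"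
  assumes "closed C" "convex C" "0 \<in> C" "\<alpha> > 0"
  shows "Psi C y s \<alpha> = ereal (psi C y s \<alpha>)"
  using assms by (simp add: psi_eq Psi_def proj_dist_def)

section \<open>Lower semicontinuous hull\<close>

text \<open>If \<open>Psi \<le> c\<close> at heights arbitrarily close to \<open>\<alpha>\<close>, then the slabs of the cone around \<open>\<alpha>\<close>
  all come within \<open>sqrt c\<close> of \<open>(y, s)\<close>, hence so does some point of the cone at height \<open>\<alpha>\<close>.\<close>

lemma lower_semicont_Psi:
  fixes C :: "'a::{real_inner, complete_space} set"
  assumes C: "closed C" "convex C" "0 \<in> C"
  shows "lower_semicont (Psi C y s)"
  unfolding lower_semicont_def le_Liminf_iff
proof (intro allI impI, rule ccontr)
  fix \<alpha> c assume less: "c < Psi C y s \<alpha>" and "\<not> (\<forall>\<^sub>F \<beta> in at \<alpha>. c < Psi C y s \<beta>)"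
  then have freq: "\<exists>\<beta>. dist \<beta> \<alpha> < \<delta> \<and> Psi C y s \<beta> \<le> c" if "\<delta> > 0" for \<delta>
    using that unfolding eventually_at by (meson not_le)
  have "0 \<le> c" using freq[of 1] Psi_nonneg order_trans by (metis zero_less_one)
  moreover have "c \<noteq> \<infinity>" using less by auto
  ultimately obtain r where c: "c = ereal r" and r: "r \<ge> 0" by (cases c) auto
  let ?K = "closure (pos_cone (C \<times> {1::real}))"
  define S where "S n = ?K \<inter> {q. \<bar>snd q - \<alpha>\<bar> \<le> 1 / real (Suc n)}" for n
  have near: "\<exists>q\<in>S n. dist (y, s) q \<le> sqrt r" for n
  proof -
    obtain \<beta> where \<beta>: "dist \<beta> \<alpha> < 1 / real (Suc n)" "Psi C y s \<beta> \<le> c"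
      using freq[of "1 / real (Suc n)"] by auto
    then have "\<beta> \<ge> 0" using c by (intro Psi_finite_imp_nonneg[of C y s]) auto
    then have "(dist (y, s) (slice_proj C y \<beta>))\<^sup>2 \<le> r"
      using \<beta> c by (simp add: Psi_eq_dist_slice_proj)
    then have "dist (y, s) (slice_proj C y \<beta>) \<le> sqrt r" by (rule real_le_rsqrt)
    moreover have "slice_proj C y \<beta> \<in> S n"
      using Psi_attained[OF C \<open>\<beta> \<ge> 0\<close>] \<beta> by (simp add: S_def dist_real_def)
    ultimately show ?thesis by blast
  qed
  have "\<exists>q. (\<forall>n. q \<in> S n) \<and> dist (y, s) q \<le> sqrt r"
  proof (rule decseq_closed_convex_Inter)
    fix n
    show "closed (S n)"
      unfolding S_def by (intro closed_Int closed_closure closed_Collect_le continuous_intros)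
    have "{q. \<bar>snd q - \<alpha>\<bar> \<le> 1 / real (Suc n)}
        = (UNIV :: 'a set) \<times> {\<alpha> - 1 / real (Suc n) .. \<alpha> + 1 / real (Suc n)}"
      by (auto simp: abs_le_iff)
    then have "convex {q :: 'a \<times> real. \<bar>snd q - \<alpha>\<bar> \<le> 1 / real (Suc n)}"
      by (simp add: convex_Times)
    then show "convex (S n)"
      unfolding S_def using C by (intro convex_Int convex_closure_pos_cone)
    show "S n \<noteq> {}" using near[of n] by auto
    show "infdist (y, s) (S n) \<le> sqrt r" using near[of n] infdist_le order_trans by metis
  next
    have "1 / real (Suc n) \<le> 1 / real (Suc m)" if "m \<le> n" for m n
      using that by (simp add: frac_le)
    then show "decseq S" by (fastforce simp: S_def decseq_def)
  qed
  then obtain q where q: "\<And>n. q \<in> S n" and qr: "dist (y, s) q \<le> sqrt r" by blast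
  have "\<bar>snd q - \<alpha>\<bar> \<le> inverse (real (Suc n))" for n
    using q[of n] by (simp add: S_def inverse_eq_divide)
  then have "\<bar>snd q - \<alpha>\<bar> \<le> 0"
    using LIMSEQ_le_const[OF LIMSEQ_inverse_real_of_nat] by blast
  then have "snd q = \<alpha>" by simp
  moreover have "(dist (y, s) q)\<^sup>2 \<le> r"
    using power_mono[OF qr, of 2] r by simp
  ultimately have "Psi C y s \<alpha> \<le> c"
    using Psi_le_dist(1)[OF C, of q y s] q[of 0] c order_trans by (fastforce simp: S_def)
  with less show False by simp
qed

text \<open>Only the value at \<open>0\<close> needs an argument; the bound used is \<open>rec_cone C \<subseteq> \<alpha> C\<close>.\<close>

lemma lsc_minorant_le_Psi:
  fixes C :: "'a::{real_inner, complete_space} set"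
  assumes C: "closed C" "convex C" "0 \<in> C"
    and G: "lower_semicont G" "G \<le> extend_infty {0<..} (psi C y s)"
  shows "G \<le> Psi C y s"
proof (rule le_funI)
  fix \<alpha> :: real
  have pos: "G \<beta> \<le> Psi C y s \<beta>" if "\<beta> > 0" for \<beta>
    using le_funD[OF G(2), of \<beta>] that C by (simp add: extend_infty_def Psi_eq_psi)
  consider "\<alpha> < 0" | "\<alpha> > 0" | "\<alpha> = 0" by linarith
  then show "G \<alpha> \<le> Psi C y s \<alpha>"
  proof cases
    case 3
    define p where "p = proj (rec_cone C) y"
    have p: "p \<in> rec_cone C" unfolding p_def
      using C zero_in_rec_cone by (intro proj_in closed_rec_cone convex_rec_cone) auto
    have bound: "G \<beta> \<le> ereal ((dist y p)\<^sup>2 + (\<beta> - s)\<^sup>2)" if "\<beta> > 0" for \<beta>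
    proof -
      have "(p, \<beta>) \<in> closure (pos_cone (C \<times> {1}))"
        using that p C rec_cone_scaleR[of C p "inverse \<beta>"] by (simp add: mem_closure_pos_cone_iff)
      from Psi_le_dist(1)[OF C this, of y s] pos[OF that] show ?thesis
        by (auto simp: dist_prod_sq intro: order_trans)
    qed
    have "G 0 \<le> Liminf (at 0) G" using G(1) by (simp add: lower_semicont_def)
    also have "\<dots> \<le> Liminf (at_right 0) G"
      unfolding le_Liminf_iff
      by (blast dest: less_LiminfD intro: filter_leD[OF at_le[OF subset_UNIV]])
    also have "\<dots> \<le> Liminf (at_right 0) (\<lambda>\<beta>. ereal ((dist y p)\<^sup>2 + (\<beta> - s)\<^sup>2))"
      by (rule Liminf_mono) (use bound in \<open>auto simp: eventually_at_right_field intro: exI[of _ 1]\<close>)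
    also have "\<dots> = ereal ((dist y p)\<^sup>2 + (0 - s)\<^sup>2)"
      by (intro lim_imp_Liminf tendsto_intros) auto
    also have "\<dots> = Psi C y s 0" by (simp add: Psi_def proj_dist_def p_def dist_norm)
    finally show ?thesis using 3 by simp
  qed (use pos Psi_neg[of \<alpha> C y s] in auto)
qed

lemma is_lsc_hull_on_Psi:
  fixes C :: "'a::{real_inner, complete_space} set"
  assumes C: "closed C" "convex C" "0 \<in> C"
  shows "is_lsc_hull_on {0<..} (psi C y s) (Psi C y s)"
proof -
  have "Psi C y s \<le> extend_infty {0<..} (psi C y s)"
    using C by (auto simp: le_fun_def extend_infty_def Psi_eq_psi)
  then show ?thesis
    unfolding is_lsc_hull_on_def using lower_semicont_Psi[OF C] lsc_minorant_le_Psi[OF C] by blast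
qed

section \<open>Strict convexity, supercoercivity and the minimizer\<close>

lemma norm_sq_convex_combination:
  fixes a b :: "'a::real_inner"
  shows "(norm ((1 - t) *\<^sub>R a + t *\<^sub>R b))\<^sup>2
    = (1 - t) * (norm a)\<^sup>2 + t * (norm b)\<^sup>2 - t * (1 - t) * (norm (a - b))\<^sup>2"
  unfolding power2_norm_eq_inner
  by (simp add: inner_diff_left inner_diff_right inner_add_left inner_add_right inner_commute
      algebra_simps)

lemma strictly_convex_Psi:
  fixes C :: "'a::{real_inner, complete_space} set"
  assumes C: "closed C" "convex C" "0 \<in> C"
  shows "strictly_convex_fun (Psi C y s)"
  unfolding strictly_convex_fun_def
proof (intro allI impI, elim conjE)
  fix a b t :: real
  assume fin: "Psi C y s a < \<infinity>" "Psi C y s b < \<infinity>" and ab: "a \<noteq> b" and t: "0 < t" "t < 1"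
  then have nonneg: "a \<ge> 0" "b \<ge> 0" using Psi_finite_imp_nonneg by blast+
  define p q where "p = slice_proj C y a" and "q = slice_proj C y b"
  define m where "m = (1 - t) *\<^sub>R p + t *\<^sub>R q"
  have "p \<noteq> q" using ab snd_slice_proj unfolding p_def q_def by metis
  have "m \<in> closure (pos_cone (C \<times> {1}))"
    unfolding m_def p_def q_def using t nonneg
    by (intro convexD convex_closure_pos_cone Psi_attained C) auto
  moreover have "snd m = (1 - t) *\<^sub>R a + t *\<^sub>R b" by (simp add: m_def p_def q_def)
  ultimately have "Psi C y s ((1 - t) *\<^sub>R a + t *\<^sub>R b) \<le> ereal ((dist (y, s) m)\<^sup>2)"
    using Psi_le_dist(1)[OF C] by metis
  also have "(y, s) - m = (1 - t) *\<^sub>R ((y, s) - p) + t *\<^sub>R ((y, s) - q)"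
    unfolding m_def by (simp only: scaleR_diff_left scaleR_diff_right) simp
  then have "(dist (y, s) m)\<^sup>2 = (1 - t) * (dist (y, s) p)\<^sup>2 + t * (dist (y, s) q)\<^sup>2
      - t * (1 - t) * (norm (p - q))\<^sup>2"
    by (simp add: dist_norm norm_sq_convex_combination norm_minus_commute[of p q])
  then have "ereal ((dist (y, s) m)\<^sup>2)
      < ereal ((1 - t) * (dist (y, s) p)\<^sup>2 + t * (dist (y, s) q)\<^sup>2)"
    using t \<open>p \<noteq> q\<close> by simp
  also have "\<dots> = ereal (1 - t) * Psi C y s a + ereal t * Psi C y s b"
    using nonneg by (simp add: Psi_eq_dist_slice_proj p_def q_def)
  finally show "Psi C y s ((1 - t) *\<^sub>R a + t *\<^sub>R b)
      < ereal (1 - t) * Psi C y s a + ereal t * Psi C y s b" .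
qed

lemma supercoercive_Psi: "supercoercive (Psi C y s)"
  unfolding supercoercive_def tendsto_PInfty
proof
  fix r :: real
  \<comment> \<open>For \<open>\<alpha> > 0\<close> the inequality \<open>\<alpha> > r + 2 s\<close> already gives
    \<open>(\<alpha> - s)\<^sup>2 > r \<alpha>\<close>.\<close>
  have "\<forall>\<^sub>F \<alpha> in at_infinity. \<bar>\<alpha>\<bar> > \<bar>r\<bar> + 2 * \<bar>s\<bar>"
    unfolding eventually_at_infinity by (intro exI[of _ "\<bar>r\<bar> + 2 * \<bar>s\<bar> + 1"]) auto
  then show "\<forall>\<^sub>F \<alpha> in at_infinity. ereal r < Psi C y s \<alpha> / ereal \<bar>\<alpha>\<bar>"
  proof eventually_elim
    case (elim \<alpha>)
    show ?case
    proof (cases "\<alpha> < 0")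
      case True
      then show ?thesis by (simp add: Psi_neg)
    next
      case False
      with elim have \<alpha>: "\<alpha> > 0" "\<alpha> > r + 2 * s" by auto
      have "0 < \<alpha> * (\<alpha> - (r + 2 * s))" using \<alpha> by simp
      moreover have "(\<alpha> - s)\<^sup>2 = \<alpha> * (\<alpha> - (r + 2 * s)) + r * \<alpha> + s\<^sup>2"
        by (simp add: power2_eq_square algebra_simps)
      ultimately have "r * \<alpha> < (\<alpha> - s)\<^sup>2" using zero_le_power2[of s] by linarith
      also have "\<dots> \<le> \<alpha>\<^sup>2 * (proj_dist C (y /\<^sub>R \<alpha>))\<^sup>2 + (\<alpha> - s)\<^sup>2" by simp
      finally show ?thesis using \<alpha> by (simp add: Psi_def less_divide_eq)
    qed
  qed
qed

text \<open>\<open>Psi C y s \<alpha>\<close> is the squared distance from \<open>(y, s)\<close> to the slice at height \<open>\<alpha>\<close>,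
  so \<open>\<alpha>\<close> minimizes it exactly if the nearest point of that slice is nearest in the whole cone.\<close>

lemma is_arg_min_Psi_iff:
  fixes C :: "'a::{real_inner, complete_space} set"
  assumes C: "closed C" "convex C" "0 \<in> C"
  shows "is_arg_min (Psi C y s) (\<lambda>_. True) \<alpha> \<longleftrightarrow>
    \<alpha> \<ge> 0 \<and> proj (closure (pos_cone (C \<times> {1}))) (y, s) = slice_proj C y \<alpha>"
    (is "?L \<longleftrightarrow> _ \<and> proj ?K _ = _")
proof
  assume L: ?L
  then have min: "Psi C y s \<alpha> \<le> Psi C y s \<beta>" for \<beta> by (auto simp: is_arg_min_def not_less)
  have "Psi C y s \<alpha> < \<infinity>"
    using min[of 0] Psi_eq_dist_slice_proj[of 0 C y s] by (auto intro: le_less_trans)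
  then have nonneg: "\<alpha> \<ge> 0" by (rule Psi_finite_imp_nonneg)
  have "dist (y, s) (slice_proj C y \<alpha>) \<le> dist (y, s) q" if "q \<in> ?K" for q
  proof -
    have "ereal ((dist (y, s) (slice_proj C y \<alpha>))\<^sup>2) \<le> ereal ((dist (y, s) q)\<^sup>2)"
      using min[of "snd q"] Psi_le_dist(1)[OF C that, of y s]
      unfolding Psi_eq_dist_slice_proj[OF nonneg] by (rule order_trans)
    then show ?thesis by (simp add: power2_le_iff_abs_le)
  qed
  then show "\<alpha> \<ge> 0 \<and> proj ?K (y, s) = slice_proj C y \<alpha>"
    using nonneg Psi_attained[OF C] convex_closure_pos_cone[OF C(2)] by (auto intro: proj_eqI)
next
  assume R: "\<alpha> \<ge> 0 \<and> proj ?K (y, s) = slice_proj C y \<alpha>"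
  have "Psi C y s \<alpha> \<le> Psi C y s \<beta>" for \<beta>
  proof (cases "\<beta> < 0")
    case True
    then show ?thesis by (simp add: Psi_neg)
  next
    case False
    then have \<beta>: "slice_proj C y \<beta> \<in> ?K" using Psi_attained[OF C] by simp
    then have "dist (y, s) (proj ?K (y, s)) \<le> dist (y, s) (slice_proj C y \<beta>)"
      using convex_closure_pos_cone[OF C(2)] by (intro proj_le) auto
    then show ?thesis using R False by (simp add: Psi_eq_dist_slice_proj power_mono)
  qed
  then show ?L by (auto simp: is_arg_min_def not_less)
qed

lemma ex1_is_arg_min_Psi:
  fixes C :: "'a::{real_inner, complete_space} set"
  assumes C: "closed C" "convex C" "0 \<in> C"
  shows "\<exists>!\<alpha>. is_arg_min (Psi C y s) (\<lambda>_. True) \<alpha>"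
proof -
  let ?K = "closure (pos_cone (C \<times> {1::real}))"
  define q where "q = proj ?K (y, s)"
  have K: "closed ?K" "convex ?K" "?K \<noteq> {}"
    using convex_closure_pos_cone[OF C(2)] Psi_attained[OF C, of 0] by auto
  have "q \<in> ?K" unfolding q_def by (rule proj_in[OF K])
  note q = Psi_le_dist[OF C this]
  \<comment> \<open>The nearest point at the height of \<open>q\<close> is no farther than \<open>q\<close>, hence is \<open>q\<close>.\<close>
  have "dist (y, s) (slice_proj C y (snd q)) \<le> dist (y, s) q"
    using q by (simp add: Psi_eq_dist_slice_proj power2_le_iff_abs_le)
  then have "proj ?K (y, s) = slice_proj C y (snd q)"
    using K Psi_attained[OF C q(2)] proj_le[OF K] unfolding q_def
    by (intro proj_eqI) (auto intro: order_trans)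
  then show ?thesis
    using q(2) snd_slice_proj by (intro ex1I[of _ "snd q"]) (auto simp: is_arg_min_Psi_iff[OF C] q_def)
qed

section \<open>Projection onto the closed cone\<close>

theorem theorem5p1:
  fixes C :: "'a::{real_inner, complete_space} set" and K :: "('a \<times> real) set"
    and y :: 'a and s :: real
  assumes "closed C" and "convex C" and "0 \<in> C"
    and K_def: "K = closure (pos_cone (C \<times> {1}))"
  shows "(\<forall>\<alpha>>0. psi C y s \<alpha> = (proj_dist ((\<lambda>x. \<alpha> *\<^sub>R x) ` C) y)\<^sup>2 + (\<alpha> - s)\<^sup>2 \<and>
                 psi C y s \<alpha> = \<alpha>\<^sup>2 * (norm (y /\<^sub>R \<alpha> - proj C (y /\<^sub>R \<alpha>)))\<^sup>2 + (\<alpha> - s)\<^sup>2) \<and>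
         (\<forall>\<alpha>. Psi C y s \<alpha> \<noteq> -\<infinity>) \<and>
         is_lsc_hull_on {0<..} (psi C y s) (Psi C y s) \<and>
         strictly_convex_fun (Psi C y s) \<and>
         supercoercive (Psi C y s) \<and>
         (\<exists>!\<alpha>. is_arg_min (Psi C y s) (\<lambda>_. True) \<alpha>) \<and>
         (\<forall>\<alpha>. is_arg_min (Psi C y s) (\<lambda>_. True) \<alpha> \<longrightarrow>
            0 \<le> \<alpha> \<and>
            proj K (y, s) =
              (if \<alpha> = 0 then (proj (rec_cone C) y, 0)
               else (\<alpha> *\<^sub>R proj C (y /\<^sub>R \<alpha>), \<alpha>)))"
proof -
  note C = assms(1-3)
  have "psi C y s \<alpha> = (proj_dist ((\<lambda>x. \<alpha> *\<^sub>R x) ` C) y)\<^sup>2 + (\<alpha> - s)\<^sup>2" for \<alpha>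
    by (simp add: psi_def proj_dist_def norm_minus_commute)
  moreover have "psi C y s \<alpha> = \<alpha>\<^sup>2 * (norm (y /\<^sub>R \<alpha> - proj C (y /\<^sub>R \<alpha>)))\<^sup>2 + (\<alpha> - s)\<^sup>2"
    if "\<alpha> > 0" for \<alpha>
    using C that by (rule psi_eq)
  moreover have "Psi C y s \<alpha> \<noteq> -\<infinity>" for \<alpha>
    using Psi_nonneg[of C y s \<alpha>] by auto
  moreover have "0 \<le> \<alpha> \<and> proj K (y, s) =
      (if \<alpha> = 0 then (proj (rec_cone C) y, 0) else (\<alpha> *\<^sub>R proj C (y /\<^sub>R \<alpha>), \<alpha>))"
    if "is_arg_min (Psi C y s) (\<lambda>_. True) \<alpha>" for \<alpha>
    using that unfolding is_arg_min_Psi_iff[OF C] K_def slice_proj_def .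
  ultimately show ?thesis
    by (intro conjI allI impI is_lsc_hull_on_Psi C strictly_convex_Psi supercoercive_Psi
        ex1_is_arg_min_Psi) simp_all
qed

end
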